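(* Let $\ell\ge 2$ be an integer. The generating function $\sum_{n\geq 1}|\mathcal P_n(\{12\cdots\ell 1\})|\,x^n$ is given by $$\frac{x^{\ell-1}(1-(\ell-1)x)}{\prod_{j=1}^{\ell}(1-jx)}+\sum_{i=1}^{\ell-2}\frac{x^i}{\prod_{j=1}^i(1-jx)}.$$
   Context: A restricted growth sequence of length $n$ is a sequence of positive integers $\pi=\pi_1\cdots\pi_n$ with $\pi_1=1$ and $\pi_{j+1}\le 1+\max\{\pi_1,\dots,\pi_j\}$ for all $1\le j<n$. Such a sequence contains a pattern $\tau$ if it has a (not necessarily consecutive) subsequence order isomorphic to $\tau$ (same relative order, including equalities); otherwise it avoids $\tau$. $\mathcal P_n(B)$ is the set of restricted growth sequences of length $n$ that avoid all patterns in $B$. The pattern $12\cdots\ell1$ is the word of length $\ell+1$ consisting of $1,2,\dots,\ell$ followed by $1$. *)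

theory Defs
  imports
    "HOL-Computational_Algebra.Formal_Power_Series"
    "HOL-Library.Sublist"
begin

text \<open>
  Sequences are lists of natural numbers, so the mathematical \<open>\<pi>\<^sub>j\<close> is \<open>\<pi> ! (j - 1)\<close>, and
  \<open>set (take j \<pi>)\<close> is \<open>{\<pi>\<^sub>1, \<dots>, \<pi>\<^sub>j}\<close>. The empty list is not a restricted growth sequence.
\<close>

definition restricted_growth :: "nat list \<Rightarrow> bool" where
  "restricted_growth \<pi> \<longleftrightarrow>
     \<pi> \<noteq> [] \<and> (\<forall>a\<in>set \<pi>. a \<ge> 1) \<and> \<pi> ! 0 = 1 \<and>
     (\<forall>j. 1 \<le> j \<and> j < length \<pi> \<longrightarrow> \<pi> ! j \<le> 1 + Max (set (take j \<pi>)))"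

text \<open>
  Quantifying over all ordered pairs of positions, preservation of \<open><\<close> in both directions
  also accounts for equalities between entries.
\<close>

definition order_isomorphic :: "nat list \<Rightarrow> nat list \<Rightarrow> bool" where
  "order_isomorphic u v \<longleftrightarrow>
     length u = length v \<and>
     (\<forall>i<length u. \<forall>j<length u. u ! i < u ! j \<longleftrightarrow> v ! i < v ! j)"

definition contains_pattern :: "nat list \<Rightarrow> nat list \<Rightarrow> bool" where
  "contains_pattern \<pi> \<tau> \<longleftrightarrow> (\<exists>\<sigma>. subseq \<sigma> \<pi> \<and> order_isomorphic \<sigma> \<tau>)"

definition avoiding_rgs :: "nat \<Rightarrow> nat list set \<Rightarrow> nat list set" where
  "avoiding_rgs n B =
     {\<pi>. restricted_growth \<pi> \<and> length \<pi> = n \<and> (\<forall>\<tau>\<in>B. \<not> contains_pattern \<pi> \<tau>)}"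

definition pattern_up_one :: "nat \<Rightarrow> nat list" where
  "pattern_up_one l = [1..<Suc l] @ [1]"

end

theory Submission
  imports Defs
begin

text \<open>
  Let \<open>m\<close> be the largest letter of a restricted growth sequence. Its letters are exactly
  \<open>1, \<dots>, m\<close>, and their first occurrences come in increasing order. Hence the longest strictly
  increasing subsequence starting with the value \<open>a \<le> m\<close> is \<open>a, a + 1, \<dots>, m\<close>, of length
  \<open>m - a + 1\<close>. Appending a letter \<open>a\<close> therefore creates an occurrence of \<open>12\<dots>l1\<close> exactly
  when \<open>m - a + 1 \<ge> l\<close>: to keep avoiding the pattern, the new letter must be \<open>m + 1\<close> or one of
  the \<open>min m (l - 1)\<close> largest letters among \<open>1, \<dots>, m\<close>.
  
  Let \<open>b n m\<close> be the number of avoiders of length \<open>n\<close> with largest letter \<open>m\<close>, the empty word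
  being counted by \<open>b 0 0 = 1\<close>. Removing the last letter gives
  \<open>b (n + 1) m = min m (l - 1) * b n m + b n (m - 1)\<close> (\<open>card_avoiders_with_max_Suc\<close>). So the
  generating function of the words with largest letter \<open>m < l\<close> is \<open>x^m / ((1 - x) \<dots> (1 - m x))\<close>
  (\<open>avoider_gf_small_max\<close>). This accounts for the summands with \<open>1 \<le> m \<le> l - 2\<close>.
  For all words with largest letter at least \<open>l - 1\<close> together, with generating function \<open>T\<close>,
  each word has \<open>l - 1\<close> extensions by an old letter and one by a new letter. Such a word also
  arises by raising the maximum \<open>l - 2\<close>. Thus \<open>T (1 - l x)\<close> is \<open>x\<close> times the generating function for
  \<open>m = l - 2\<close> (\<open>large_max_gf_recurrence\<close>), which gives the first summand after expanding the
  fraction by \<open>1 - (l - 1) x\<close>.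
\<close>

section \<open>Avoidance as a condition on each letter\<close>

text \<open>
  The largest letter of a word, with the value \<open>0\<close> for the empty word. With this convention
  the growth condition also covers the first letter.
\<close>

definition largest_letter :: "nat list \<Rightarrow> nat" where
  "largest_letter \<pi> = Max (insert 0 (set \<pi>))"

lemma largest_letter_Nil [simp]: "largest_letter [] = 0"
  by (simp add: largest_letter_def)

lemma largest_letter_snoc [simp]:
  "largest_letter (\<pi> @ [a]) = max (largest_letter \<pi>) a"
proof -
  have "insert 0 (set (\<pi> @ [a])) = insert a (insert 0 (set \<pi>))"
    by auto
  then show ?thesis
    unfolding largest_letter_def by (simp only: Max_insert finite_insert finite_set max.commute) simp
qed

lemma le_largest_letter: "a \<in> set \<pi> \<Longrightarrow> a \<le> largest_letter \<pi>"
  by (simp add: largest_letter_def)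

lemma largest_letter_eq_Max: "\<pi> \<noteq> [] \<Longrightarrow> largest_letter \<pi> = Max (set \<pi>)"
  by (simp add: largest_letter_def)

text \<open>
  The restricted growth condition, extended to the empty word.
\<close>

definition growth_word :: "nat list \<Rightarrow> bool" where
  "growth_word \<pi> \<longleftrightarrow>
     (\<forall>j<length \<pi>. 1 \<le> \<pi> ! j \<and> \<pi> ! j \<le> Suc (largest_letter (take j \<pi>)))"

text \<open>
  For \<open>l \<ge> 1\<close> and positive letters: no letter \<open>a\<close> is preceded by letters as large as \<open>a + l - 1\<close>. In a growth word, a preceding
  letter of that size forces the values \<open>a, \<dots>, a + l - 1\<close> to occur in this order before the letter \<open>a\<close>.
  The inequality is stated without subtraction.
\<close>

definition low_letter_free :: "nat \<Rightarrow> nat list \<Rightarrow> bool" where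
  "low_letter_free l \<pi> \<longleftrightarrow>
     (\<forall>j<length \<pi>. Suc (largest_letter (take j \<pi>)) < \<pi> ! j + l)"

lemma growth_word_Nil [simp]: "growth_word []"
  and low_letter_free_Nil [simp]: "low_letter_free l []"
  by (simp_all add: growth_word_def low_letter_free_def)

lemma growth_word_snoc [simp]:
  "growth_word (\<pi> @ [a]) \<longleftrightarrow>
     growth_word \<pi> \<and> 1 \<le> a \<and> a \<le> Suc (largest_letter \<pi>)"
  unfolding growth_word_def by (auto simp: less_Suc_eq nth_append)

lemma low_letter_free_snoc [simp]:
  "low_letter_free l (\<pi> @ [a]) \<longleftrightarrow>
     low_letter_free l \<pi> \<and> Suc (largest_letter \<pi>) < a + l"
  unfolding low_letter_free_def by (auto simp: less_Suc_eq nth_append)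

lemma growth_word_take: "growth_word \<pi> \<Longrightarrow> growth_word (take j \<pi>)"
  by (auto simp: growth_word_def min_def)

lemma restricted_growth_iff_growth_word:
  "restricted_growth \<pi> \<longleftrightarrow> \<pi> \<noteq> [] \<and> growth_word \<pi>"
proof (cases "\<pi> = []")
  case False
  have le: "Suc (Max (set (take j \<pi>))) = Suc (largest_letter (take j \<pi>))" if "1 \<le> j" for j
    using that False by (subst largest_letter_eq_Max) auto
  have first: "\<pi> ! 0 \<ge> 1 \<and> \<pi> ! 0 \<le> 1 \<longleftrightarrow> \<pi> ! 0 = 1"
    by auto
  have split: "(\<forall>j<length \<pi>. Q j) \<longleftrightarrow> Q 0 \<and> (\<forall>j. 1 \<le> j \<and> j < length \<pi> \<longrightarrow> Q j)" for Q
    using False by (metis One_nat_def Suc_leI length_greater_0_conv not_gr_zero)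
  have "restricted_growth \<pi> \<longleftrightarrow>
      \<pi> ! 0 = 1 \<and> (\<forall>j. 1 \<le> j \<and> j < length \<pi> \<longrightarrow>
        1 \<le> \<pi> ! j \<and> \<pi> ! j \<le> Suc (largest_letter (take j \<pi>)))"
    unfolding restricted_growth_def all_set_conv_all_nth split using False le by auto
  also have "\<dots> \<longleftrightarrow> growth_word \<pi>"
    unfolding growth_word_def split using first by simp
  finally show ?thesis using False by simp
qed (simp add: restricted_growth_def)

text \<open>
  A growth word reaches each new maximum in steps of one.
\<close>

lemma growth_word_initial_letters:
  "growth_word \<pi> \<Longrightarrow> subseq [1..<Suc (largest_letter \<pi>)] \<pi>"
proof (induction \<pi> rule: rev_induct)
  case (snoc a \<pi>)
  then have IH: "subseq [1..<Suc (largest_letter \<pi>)] \<pi>" and a: "1 \<le> a" "a \<le> Suc (largest_letter \<pi>)"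
    by auto
  show ?case
  proof (cases "a = Suc (largest_letter \<pi>)")
    case True
    have "subseq ([1..<Suc (largest_letter \<pi>)] @ [a]) (\<pi> @ [a])"
      using IH by (simp del: upt_Suc)
    then show ?thesis using True by simp
  next
    case False
    moreover have "subseq \<pi> (\<pi> @ [a])"
      by (simp add: prefix_imp_subseq)
    ultimately show ?thesis
      using subseq_order.trans[OF IH] a by (simp add: max_absorb1 del: upt_Suc)
  qed
qed simp

text \<open>
  This direction needs no growth condition: \<open>l\<close> strictly increasing letters starting with \<open>a\<close> end
  at \<open>a + l - 1\<close> or above.
\<close>

lemma contains_pattern_imp_low_letter:
  assumes "l \<ge> 1" and "contains_pattern \<pi> (pattern_up_one l)"
  shows "\<not> low_letter_free l \<pi>"
proof -
  obtain \<sigma> where sub: "subseq \<sigma> \<pi>" and iso: "order_isomorphic \<sigma> (pattern_up_one l)"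
    using assms(2) by (auto simp: contains_pattern_def)
  have len: "length \<sigma> = Suc l"
    using iso by (simp add: order_isomorphic_def pattern_up_one_def)
  have val: "pattern_up_one l ! i = (if i < l then Suc i else 1)" if "i \<le> l" for i
    using that by (auto simp: pattern_up_one_def nth_append simp del: upt_Suc)
  have cmp: "\<sigma> ! i < \<sigma> ! j \<longleftrightarrow> pattern_up_one l ! i < pattern_up_one l ! j"
    if "i \<le> l" "j \<le> l" for i j
    using iso len that by (auto simp: order_isomorphic_def)
  \<comment> \<open>The first and last entries of the pattern are equal, so neither of the corresponding letters is smaller.\<close>
  have eq: "\<sigma> ! l = \<sigma> ! 0"
    using cmp[of 0 l] cmp[of l 0] assms(1) by (auto simp: val)
  have grow: "\<sigma> ! 0 + i \<le> \<sigma> ! i" if "i < l" for i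
    using that
  proof (induction i)
    case (Suc i)
    then show ?case using cmp[of i "Suc i"] by (auto simp: val)
  qed simp
  define a where "a = \<sigma> ! 0"
  define \<tau> where "\<tau> = take l \<sigma>"
  have split: "\<sigma> = \<tau> @ [a]"
    unfolding \<tau>_def a_def using len eq by (metis lessI take_Suc_conv_app_nth take_all order_refl)
  obtain us vs where uv: "\<pi> = us @ vs" "subseq \<tau> us" "subseq [a] vs"
    using sub unfolding split by (auto dest: list_emb_appendD)
  then obtain ps qs where vs: "vs = ps @ a # qs"
    by (auto simp: subseq_singleton_left dest: split_list)
  have "\<sigma> ! (l - 1) \<in> set \<tau>"
    unfolding \<tau>_def in_set_conv_nth by (rule exI[of _ "l - 1"]) (use assms(1) len in simp)
  then have "\<sigma> ! (l - 1) \<in> set (us @ ps)"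
    using uv(2) by (auto dest: list_emb_set)
  then have "\<sigma> ! (l - 1) \<le> largest_letter (us @ ps)"
    by (rule le_largest_letter)
  then have "a + (l - 1) \<le> largest_letter (us @ ps)"
    using grow[of "l - 1"] assms(1) unfolding a_def by simp
  moreover have "take (length (us @ ps)) \<pi> = us @ ps" "\<pi> ! length (us @ ps) = a"
    "length (us @ ps) < length \<pi>"
    using uv vs by (auto simp: nth_append)
  ultimately show ?thesis
    using assms(1) unfolding low_letter_free_def by (intro notI) (drule spec[of _ "length (us @ ps)"], auto)
qed

text \<open>
  Conversely, the occurrence found has consecutive values \<open>a, a + 1, \<dots>, a + l - 1\<close>, followed
  by \<open>a\<close>.
\<close>

lemma low_letter_imp_contains_pattern:
  assumes "growth_word \<pi>" and "\<not> low_letter_free l \<pi>"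
  shows "contains_pattern \<pi> (pattern_up_one l)"
proof -
  obtain j where j: "j < length \<pi>" "\<pi> ! j + l \<le> Suc (largest_letter (take j \<pi>))"
    using assms(2) by (auto simp: low_letter_free_def not_less)
  define a where "a = \<pi> ! j"
  define m where "m = largest_letter (take j \<pi>)"
  have a: "1 \<le> a" "a + l \<le> Suc m"
    using assms(1) j by (auto simp: growth_word_def a_def m_def)
  have "[1..<Suc m] = [1..<a] @ [a..<a + l] @ [a + l..<Suc m]"
    using a by (metis le_add1 upt_add_eq_append le_trans le_Suc_ex)
  then have "subseq [a..<a + l] [1..<Suc m]"
    by (metis list_emb_append_mono list_emb_Nil append_Nil append_Nil2 subseq_order.refl)
  also have "subseq [1..<Suc m] (take j \<pi>)"
    unfolding m_def by (rule growth_word_initial_letters[OF growth_word_take[OF assms(1)]])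
  finally have "subseq ([a..<a + l] @ [a]) (take j \<pi> @ [a])"
    by simp
  also have "take j \<pi> @ [a] = take (Suc j) \<pi>"
    using j(1) by (simp add: a_def take_Suc_conv_app_nth)
  also have "subseq (take (Suc j) \<pi>) \<pi>"
    by (simp add: prefix_imp_subseq take_is_prefix)
  finally have "subseq ([a..<a + l] @ [a]) \<pi>" .
  moreover have "order_isomorphic ([a..<a + l] @ [a]) (pattern_up_one l)"
    by (auto simp: order_isomorphic_def pattern_up_one_def nth_append simp del: upt_Suc)
  ultimately show ?thesis
    unfolding contains_pattern_def by blast
qed

section \<open>Counting avoiders by length and largest letter\<close>

text \<open>
  For \<open>n, l \<ge> 1\<close> these are the restricted growth sequences of length \<open>n\<close> with largest letter \<open>m\<close>
  that avoid \<open>12\<dots>l1\<close>. For \<open>n = 0\<close> the empty word is included when \<open>m = 0\<close>, which makes the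
  recurrence in \<open>n\<close> hold from the start.
\<close>

definition avoiders_with_max :: "nat \<Rightarrow> nat \<Rightarrow> nat \<Rightarrow> nat list set" where
  "avoiders_with_max l n m =
     {\<pi>. growth_word \<pi> \<and> low_letter_free l \<pi> \<and> length \<pi> = n \<and> largest_letter \<pi> = m}"

lemma avoiding_rgs_eq_Union:
  assumes "l \<ge> 1" "n \<ge> 1"
  shows "avoiding_rgs n {pattern_up_one l} = (\<Union>m. avoiders_with_max l n m)"
proof -
  have "contains_pattern \<pi> (pattern_up_one l) \<longleftrightarrow> \<not> low_letter_free l \<pi>"
    if "growth_word \<pi>" for \<pi>
    using contains_pattern_imp_low_letter[OF assms(1)] low_letter_imp_contains_pattern that by blast
  then show ?thesis
    using assms(2) by (auto simp: avoiding_rgs_def avoiders_with_max_def restricted_growth_iff_growth_word)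
qed

lemma avoiders_with_max_0:
  "avoiders_with_max l 0 m = (if m = 0 then {[]} else {})"
  by (auto simp: avoiders_with_max_def)

text \<open>
  The last letter either repeats a value at most \<open>m\<close> and leaves the largest letter unchanged, or
  is the new maximum \<open>m\<close>.
\<close>

lemma avoiders_with_max_Suc:
  assumes "l \<ge> 1"
  shows "avoiders_with_max l (Suc n) m =
    (\<lambda>(\<pi>, a). \<pi> @ [a]) ` (avoiders_with_max l n m \<times> {a. 1 \<le> a \<and> a \<le> m \<and> Suc m < a + l}) \<union>
    (\<lambda>\<pi>. \<pi> @ [m]) ` (if m = 0 then {} else avoiders_with_max l n (m - 1))" (is "?L = ?A \<union> ?B")
proof (intro equalityI subsetI)
  fix \<rho> assume "\<rho> \<in> ?L"
  then obtain \<pi> a where \<rho>: "\<rho> = \<pi> @ [a]" and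
    h: "growth_word \<pi>" "low_letter_free l \<pi>" "length \<pi> = n" "1 \<le> a" "a \<le> Suc (largest_letter \<pi>)"
      "Suc (largest_letter \<pi>) < a + l" "max (largest_letter \<pi>) a = m"
    by (cases \<rho> rule: rev_cases) (auto simp: avoiders_with_max_def)
  show "\<rho> \<in> ?A \<union> ?B"
  proof (cases "a = Suc (largest_letter \<pi>)")
    case True
    then show ?thesis using h by (auto simp: \<rho> avoiders_with_max_def)
  next
    case False
    then have "largest_letter \<pi> = m" using h by auto
    then show ?thesis using h by (auto simp: \<rho> avoiders_with_max_def)
  qed
next
  fix \<rho> assume "\<rho> \<in> ?A \<union> ?B"
  then show "\<rho> \<in> ?L"
    using assms by (auto simp: avoiders_with_max_def split: if_splits)
qed

lemma finite_avoiders_with_max: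
  assumes "l \<ge> 1"
  shows "finite (avoiders_with_max l n m)"
proof (induction n arbitrary: m)
  case (Suc n)
  have "finite {a. 1 \<le> a \<and> a \<le> m \<and> Suc m < a + l}"
    by (rule finite_subset[of _ "{..m}"]) auto
  then show ?case
    unfolding avoiders_with_max_Suc[OF assms] using Suc by auto
qed (simp add: avoiders_with_max_0)

lemma card_avoiders_with_max_Suc:
  assumes "l \<ge> 1"
  shows "card (avoiders_with_max l (Suc n) m) =
    min m (l - 1) * card (avoiders_with_max l n m) +
    (if m = 0 then 0 else card (avoiders_with_max l n (m - 1)))"
proof -
  let ?I = "{a. 1 \<le> a \<and> a \<le> m \<and> Suc m < a + l}"
  let ?A = "(\<lambda>(\<pi>, a). \<pi> @ [a]) ` (avoiders_with_max l n m \<times> ?I)"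
  let ?B = "(\<lambda>\<pi>. \<pi> @ [m]) ` (if m = 0 then {} else avoiders_with_max l n (m - 1))"
  have I: "?I = {max 1 (Suc (Suc m) - l)..m}"
    by auto
  have cardI: "card ?I = min m (l - 1)"
    unfolding I using assms by (auto simp: max_def min_def)
  have "finite ?A" "finite ?B"
    using finite_avoiders_with_max[OF assms] unfolding I by auto
  moreover have "?A \<inter> ?B = {}"
    by (auto simp: avoiders_with_max_def split: if_splits)
  moreover have "card ?A = card (avoiders_with_max l n m) * min m (l - 1)"
    unfolding cardI[symmetric] by (subst card_image) (auto simp: inj_on_def card_cartesian_product)
  moreover have "card ?B = (if m = 0 then 0 else card (avoiders_with_max l n (m - 1)))"
    by (subst card_image) (auto simp: inj_on_def)
  ultimately show ?thesis
    unfolding avoiders_with_max_Suc[OF assms] by (simp add: card_Un_disjoint mult.commute)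
qed

lemma avoiders_with_max_empty:
  assumes "l \<ge> 1" "m > n"
  shows "avoiders_with_max l n m = {}"
  using assms(2)
proof (induction n arbitrary: m)
  case (Suc n)
  then show ?case by (auto simp: avoiders_with_max_Suc[OF assms(1)])
qed (simp add: avoiders_with_max_0)

text \<open>
  The largest letter never exceeds \<open>n\<close>. The looser bound \<open>n + l\<close> ensures that the range includes
  all of \<open>{1..l - 2}\<close>, so that it can be split there without a case distinction on \<open>n\<close>.
\<close>

lemma card_avoiding_rgs:
  assumes "l \<ge> 1" "n \<ge> 1"
  shows "card (avoiding_rgs n {pattern_up_one l}) =
    (\<Sum>m = 1..n + l. card (avoiders_with_max l n m))"
proof -
  have zero: "avoiders_with_max l n 0 = {}"
    using assms(2) by (cases n) (auto simp: avoiders_with_max_Suc[OF assms(1)])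
  have "m \<in> {1..n + l}" if "\<pi> \<in> avoiders_with_max l n m" for \<pi> m
    using that zero avoiders_with_max_empty[OF assms(1), of n m]
    by (cases "m = 0"; cases "m > n") auto
  then have "avoiding_rgs n {pattern_up_one l} = (\<Union>m\<in>{1..n + l}. avoiders_with_max l n m)"
    unfolding avoiding_rgs_eq_Union[OF assms] by blast
  also have "card \<dots> = (\<Sum>m = 1..n + l. card (avoiders_with_max l n m))"
    by (rule card_UN_disjoint)
      (auto simp: finite_avoiders_with_max[OF assms(1)], auto simp: avoiders_with_max_def)
  finally show ?thesis .
qed

section \<open>Generating functions\<close>

text \<open>
  The generating function by length of the avoiders with largest letter \<open>m\<close>.
\<close>

definition avoider_gf :: "nat \<Rightarrow> nat \<Rightarrow> rat fps" where
  "avoider_gf l m = Abs_fps (\<lambda>n. of_nat (card (avoiders_with_max l n m)))"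

lemma one_minus_const_times_X_nth:
  fixes F :: "rat fps"
  shows "fps_nth (F * (1 - of_nat c * fps_X)) n =
    fps_nth F n - (if n = 0 then 0 else of_nat c * fps_nth F (n - 1))"
proof -
  have "F * (1 - of_nat c * fps_X) = F - fps_const (of_nat c) * (fps_X * F)"
    by (simp add: algebra_simps fps_of_nat)
  then show ?thesis by simp
qed

lemma avoider_gf_0:
  assumes "l \<ge> 1"
  shows "avoider_gf l 0 = 1"
proof (rule fps_ext)
  fix n show "fps_nth (avoider_gf l 0) n = fps_nth 1 n"
    by (cases n) (simp_all add: avoider_gf_def avoiders_with_max_0 card_avoiders_with_max_Suc[OF assms])
qed

lemma avoider_gf_Suc:
  assumes "l \<ge> 1"
  shows "avoider_gf l (Suc m) * (1 - of_nat (min (Suc m) (l - 1)) * fps_X) = fps_X * avoider_gf l m"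
proof (rule fps_ext)
  fix n
  show "fps_nth (avoider_gf l (Suc m) * (1 - of_nat (min (Suc m) (l - 1)) * fps_X)) n =
      fps_nth (fps_X * avoider_gf l m) n"
    unfolding one_minus_const_times_X_nth
    by (cases n) (simp_all add: avoider_gf_def avoiders_with_max_0 card_avoiders_with_max_Suc[OF assms])
qed

lemma avoider_gf_small_max:
  assumes "l \<ge> 1" "m < l"
  shows "avoider_gf l m * (\<Prod>j = 1..m. 1 - of_nat j * fps_X) = fps_X ^ m"
  using assms(2)
proof (induction m)
  case (Suc m)
  have "avoider_gf l (Suc m) * (\<Prod>j = 1..Suc m. 1 - of_nat j * fps_X) =
      avoider_gf l (Suc m) * (1 - of_nat (Suc m) * fps_X) * (\<Prod>j = 1..m. 1 - of_nat j * fps_X)"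
    by (simp add: mult_ac del: of_nat_Suc)
  also have "avoider_gf l (Suc m) * (1 - of_nat (Suc m) * fps_X) = fps_X * avoider_gf l m"
    using avoider_gf_Suc[OF assms(1), of m] Suc.prems by (simp add: min_absorb1 del: of_nat_Suc)
  also have "\<dots> * (\<Prod>j = 1..m. 1 - of_nat j * fps_X) = fps_X ^ Suc m"
    using Suc by (simp add: mult.assoc)
  finally show ?case .
qed (simp add: avoider_gf_0[OF assms(1)])

text \<open>
  The generating function of the avoiders with largest letter at least \<open>l - 1\<close>. Since the largest
  letter is at most the length \<open>n\<close>, the upper limit \<open>n + l\<close> only adds zero terms.
\<close>

definition large_max_gf :: "nat \<Rightarrow> rat fps" where
  "large_max_gf l = Abs_fps (\<lambda>n. \<Sum>m = l - 1..n + l. of_nat (card (avoiders_with_max l n m)))"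

text \<open>
  From the maximum \<open>l - 1\<close> on, the factor \<open>min m (l - 1)\<close> is constant, so the recurrences for the
  individual \<open>m\<close> add up to a single one.
\<close>

lemma large_max_gf_recurrence:
  assumes "l \<ge> 2"
  shows "large_max_gf l * (1 - of_nat l * fps_X) = fps_X * avoider_gf l (l - 2)"
proof (rule fps_ext)
  fix n
  define b :: "nat \<Rightarrow> nat \<Rightarrow> rat" where "b = (\<lambda>n m. of_nat (card (avoiders_with_max l n m)))"
  have l: "l \<ge> 1" using assms by simp
  obtain k where k: "l = Suc (Suc k)"
    using assms by (metis add_2_eq_Suc le_Suc_ex)
  have T: "fps_nth (large_max_gf l) n = (\<Sum>m = Suc k..n + l. b n m)" for n
    by (simp add: large_max_gf_def b_def k)
  have b0: "b n m = 0" if "m > n" for n m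
    using avoiders_with_max_empty[OF l that] by (simp add: b_def)
  have rec: "fps_nth (large_max_gf l) (Suc n) = of_nat l * fps_nth (large_max_gf l) n + b n (l - 2)" for n
  proof -
    have "b (Suc n) m = of_nat (Suc k) * b n m + b n (m - 1)" if "m \<ge> Suc k" for m
    proof -
      have "min m (l - 1) = Suc k" "m \<noteq> 0" using that by (auto simp: k)
      then show ?thesis
        unfolding b_def card_avoiders_with_max_Suc[OF l] by (simp add: algebra_simps)
    qed
    then have "fps_nth (large_max_gf l) (Suc n) =
        (\<Sum>m = Suc k..Suc (n + l). of_nat (Suc k) * b n m + b n (m - 1))"
      unfolding T by (intro sum.cong) auto
    also have "\<dots> = of_nat (Suc k) * (\<Sum>m = Suc k..Suc (n + l). b n m) +
        (\<Sum>m = Suc k..Suc (n + l). b n (m - 1))"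
      by (simp only: sum.distrib sum_distrib_left)
    \<comment> \<open>The two sums run over \<open>m \<ge> l - 1\<close> and, after the shift, over \<open>m \<ge> l - 2\<close>; the extra term of the second is the inflow from maximum \<open>l - 2\<close>.\<close>
    also have "(\<Sum>m = Suc k..Suc (n + l). b n m) = fps_nth (large_max_gf l) n"
      unfolding T by (simp add: b0 k)
    also have "(\<Sum>m = Suc k..Suc (n + l). b n (m - 1)) = (\<Sum>m = k..n + l. b n m)"
      by (simp only: sum.shift_bounds_cl_Suc_ivl diff_Suc_1)
    also have "(\<Sum>m = k..n + l. b n m) = b n k + fps_nth (large_max_gf l) n"
      unfolding T by (rule sum.atLeast_Suc_atMost) (simp add: k)
    finally show ?thesis by (simp add: k algebra_simps)
  qed
  have "fps_nth (large_max_gf l) 0 = 0"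
    unfolding T by (rule sum.neutral) (auto simp: b0)
  then show "fps_nth (large_max_gf l * (1 - of_nat l * fps_X)) n =
      fps_nth (fps_X * avoider_gf l (l - 2)) n"
    unfolding one_minus_const_times_X_nth
    by (cases n) (simp_all add: rec avoider_gf_def b_def)
qed

lemma prod_one_minus_const_X_nonzero:
  "(\<Prod>j = 1..m. 1 - of_nat j * fps_X :: rat fps) \<noteq> 0"
proof -
  have "fps_nth (1 - of_nat j * fps_X :: rat fps) 0 = 1" for j
    by simp
  then have "(1 - of_nat j * fps_X :: rat fps) \<noteq> 0" for j
    by (metis fps_zero_nth zero_neq_one)
  then show ?thesis by simp
qed

theorem theorem5p4:
  fixes l :: nat
  assumes "l \<ge> 2"
  shows "Abs_fps (\<lambda>n. if n \<ge> 1 then of_nat (card (avoiding_rgs n {pattern_up_one l})) else 0) =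
    (fps_X ^ (l - 1) * (1 - of_nat (l - 1) * fps_X) / (\<Prod>j = 1..l. 1 - of_nat j * fps_X)
     + (\<Sum>i = 1..l - 2. fps_X ^ i / (\<Prod>j = 1..i. 1 - of_nat j * fps_X)) :: rat fps)"
proof -
  let ?P = "\<lambda>m. (\<Prod>j = 1..m. 1 - of_nat j * fps_X :: rat fps)"
  have l: "l \<ge> 1" using assms by simp
  obtain k where k: "l = Suc (Suc k)"
    using assms by (metis add_2_eq_Suc le_Suc_ex)
  have small: "avoider_gf l i = fps_X ^ i / ?P i" if "i \<in> {1..l - 2}" for i
  proof -
    have "fps_X ^ i = avoider_gf l i * ?P i"
      using avoider_gf_small_max[OF l, of i] that assms by auto
    then show ?thesis
      using prod_one_minus_const_X_nonzero[of i] by simp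
  qed
  \<comment> \<open>The recurrence and the product for maximum \<open>l - 2\<close> account for all factors except the one with \<open>j = l - 1\<close>, which therefore remains in the numerator.\<close>
  have "large_max_gf l * ?P l =
      large_max_gf l * (1 - of_nat l * fps_X) * ?P (l - 2) * (1 - of_nat (l - 1) * fps_X)"
    unfolding k by (simp add: mult_ac del: of_nat_Suc)
  also have "\<dots> = fps_X * (avoider_gf l (l - 2) * ?P (l - 2)) * (1 - of_nat (l - 1) * fps_X)"
    unfolding large_max_gf_recurrence[OF assms] by (simp only: mult_ac)
  also have "\<dots> = fps_X ^ (l - 1) * (1 - of_nat (l - 1) * fps_X)"
    using avoider_gf_small_max[OF l, of "l - 2"] by (simp add: k del: of_nat_Suc)
  finally have large: "large_max_gf l = fps_X ^ (l - 1) * (1 - of_nat (l - 1) * fps_X) / ?P l"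
    using prod_one_minus_const_X_nonzero[of l]
    by (metis nonzero_mult_div_cancel_right)
  have "Abs_fps (\<lambda>n. if n \<ge> 1 then of_nat (card (avoiding_rgs n {pattern_up_one l})) else 0) =
      large_max_gf l + (\<Sum>i = 1..l - 2. avoider_gf l i)"
  proof (rule fps_ext)
    fix n
    let ?b = "\<lambda>m. of_nat (card (avoiders_with_max l n m)) :: rat"
    have "(if n \<ge> 1 then of_nat (card (avoiding_rgs n {pattern_up_one l})) else 0) =
        (\<Sum>m = 1..n + l. ?b m)"
      using card_avoiding_rgs[OF l, of n] by (auto simp: avoiders_with_max_0 not_le)
    also have "{1..n + l} = {1..l - 2} \<union> {l - 1..n + l}"
      using assms by auto
    also have "(\<Sum>m\<in>{1..l - 2} \<union> {l - 1..n + l}. ?b m) =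
        (\<Sum>m = 1..l - 2. ?b m) + (\<Sum>m = l - 1..n + l. ?b m)"
      using assms by (intro sum.union_disjoint) auto
    finally show "fps_nth (Abs_fps (\<lambda>n. if n \<ge> 1 then of_nat (card (avoiding_rgs n {pattern_up_one l})) else 0)) n =
        fps_nth (large_max_gf l + (\<Sum>i = 1..l - 2. avoider_gf l i)) n"
      by (simp add: large_max_gf_def avoider_gf_def fps_sum_nth)
  qed
  also have "(\<Sum>i = 1..l - 2. avoider_gf l i) = (\<Sum>i = 1..l - 2. fps_X ^ i / ?P i)"
    by (rule sum.cong) (simp_all only: small refl)
  finally show ?thesis
    unfolding large .
qed

end
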